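(* Let $G$ be a graph with vertices $a_1,a_2,\dots,a_m$ and let $K_n$ be the complete graph with vertices $b_1,b_2,\dots,b_n$. Consider the composition $H=G\circ K_n$. Then for all $i\in\{1,\dots,m\}$ and $j\in\{1,\dots,n\}$, $${}_{H}d_d\big((a_i,b_j)\big)={}_{G}d_d(a_i).$$
   Context: Graphs are finite, simple and undirected, with nonempty vertex set. A dominating set of a graph $F$ is a set $D\subseteq V(F)$ such that every vertex in $V(F)\setminus D$ is adjacent to some vertex of $D$. A minimal dominating set is a dominating set that does not properly contain any other dominating set. The domination degree of a vertex $v$ in $F$ is ${}_{F}d_d(v)=\min\{|D| : D \text{ is a minimal dominating set of } F \text{ with } v\in D\}$. The composition $G_1\circ G_2$ has vertex set $V(G_1)\times V(G_2)$, and $(u,v)$, $(u',v')$ are adjacent iff either $u$ is adjacent to $u'$ in $G_1$, or $u=u'$ and $v$ is adjacent to $v'$ in $G_2$. *)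

theory Defs
  imports "Graph_Theory.Kuratowski"
begin

text \<open>An undirected edge {u, v} of a simple graph is represented by the two arcs (u, v) and
  (v, u). The locale \<^locale>\<open>pair_graph\<close> admits the null graph, which is excluded here.\<close>

definition simple_graph :: "'a pair_pre_digraph \<Rightarrow> bool" where
  "simple_graph G \<longleftrightarrow> pair_graph G \<and> pverts G \<noteq> {}"

definition dominating_set :: "'a pair_pre_digraph \<Rightarrow> 'a set \<Rightarrow> bool" where
  "dominating_set F D \<longleftrightarrow>
     D \<subseteq> pverts F \<and> (\<forall>v \<in> pverts F - D. \<exists>u \<in> D. (v, u) \<in> parcs F)"

definition minimal_dominating_set :: "'a pair_pre_digraph \<Rightarrow> 'a set \<Rightarrow> bool" where
  "minimal_dominating_set F D \<longleftrightarrow>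
     dominating_set F D \<and> \<not> (\<exists>D'. D' \<subset> D \<and> dominating_set F D')"

definition domination_degree :: "'a pair_pre_digraph \<Rightarrow> 'a \<Rightarrow> nat" where
  "domination_degree F v = Min {card D | D. minimal_dominating_set F D \<and> v \<in> D}"

definition composition ::
  "'a pair_pre_digraph \<Rightarrow> 'b pair_pre_digraph \<Rightarrow> ('a \<times> 'b) pair_pre_digraph" where
  "composition G1 G2 =
     \<lparr> pverts = pverts G1 \<times> pverts G2,
       parcs = {((u, v), (u', v')) | u v u' v'.
         (u, v) \<in> pverts G1 \<times> pverts G2 \<and> (u', v') \<in> pverts G1 \<times> pverts G2 \<and>
         ((u, u') \<in> parcs G1 \<or> u = u' \<and> (v, v') \<in> parcs G2)} \<rparr>"

lemma simple_graph_composition: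
  assumes "simple_graph G1" "simple_graph G2"
  shows "simple_graph (composition G1 G2)"
proof -
  interpret G1: pair_graph G1 using assms(1) by (simp add: simple_graph_def)
  interpret G2: pair_graph G2 using assms(2) by (simp add: simple_graph_def)
  let ?H = "composition G1 G2"
  have sub: "parcs ?H \<subseteq> pverts ?H \<times> pverts ?H" by (auto simp: composition_def)
  have fin: "finite (pverts ?H)" by (simp add: composition_def)
  have finA: "finite (parcs ?H)"
    using sub fin by (meson finite_SigmaI finite_subset)
  have noloop: "fst e \<noteq> snd e" if "e \<in> parcs ?H" for e
    using that G1.pair_no_loops G2.pair_no_loops by (fastforce simp: composition_def)
  have s1: "(y, x) \<in> parcs G1" if "(x, y) \<in> parcs G1" for x y
    using that G1.arcs_symmetric by blast
  have s2: "(y, x) \<in> parcs G2" if "(x, y) \<in> parcs G2" for x y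
    using that G2.arcs_symmetric by blast
  have sym: "sym (parcs ?H)"
    by (rule symI) (auto simp: composition_def dest: s1 s2)
  have "pair_graph ?H"
    using sub fin finA noloop sym
    by unfold_locales (auto simp: symmetric_def)
  moreover have "pverts ?H \<noteq> {}"
    using assms by (auto simp: composition_def simple_graph_def)
  ultimately show ?thesis by (simp add: simple_graph_def)
qed

text \<open>The minimum defining \<^const>\<open>domination_degree\<close> ranges over a finite nonempty set: a maximal
  independent set containing the given vertex is a minimal dominating set.\<close>

lemma finite_domination_degree_set:
  assumes "simple_graph F"
  shows "finite {card D | D. minimal_dominating_set F D \<and> v \<in> D}"
proof -
  interpret pair_graph F using assms by (simp add: simple_graph_def)
  have "{card D | D. minimal_dominating_set F D \<and> v \<in> D} \<subseteq> card ` Pow (pverts F)"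
    by (auto simp: minimal_dominating_set_def dominating_set_def)
  then show ?thesis by (rule finite_subset) simp
qed

lemma ex_minimal_dominating_set:
  assumes "simple_graph F" "v \<in> pverts F"
  shows "\<exists>D. minimal_dominating_set F D \<and> v \<in> D"
proof -
  interpret pair_graph F using assms by (simp add: simple_graph_def)
  define I where
    "I = {D. D \<subseteq> pverts F \<and> v \<in> D \<and> (\<forall>x\<in>D. \<forall>y\<in>D. (x, y) \<notin> parcs F)}"
  have sym: "(y, x) \<in> parcs F" if "(x, y) \<in> parcs F" for x y
    using that arcs_symmetric by blast
  have irr: "(x, x) \<notin> parcs F" for x
    using pair_no_loops by fastforce
  have "finite I"
    by (rule finite_subset[of _ "Pow (pverts F)"]) (auto simp: I_def)
  moreover have "{v} \<in> I"
    using assms(2) irr by (auto simp: I_def)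
  ultimately obtain D where D: "D \<in> I" "\<And>E. E \<in> I \<Longrightarrow> D \<subseteq> E \<Longrightarrow> D = E"
    using finite_has_maximal[of I] by blast
  have dom: "dominating_set F D"
  proof -
    have "\<exists>u\<in>D. (x, u) \<in> parcs F" if x: "x \<in> pverts F" "x \<notin> D" for x
    proof (rule ccontr)
      assume "\<not> ?thesis"
      then have "insert x D \<in> I" using D(1) x irr sym by (auto simp: I_def)
      then show False using D(2) x by blast
    qed
    then show ?thesis using D(1) by (auto simp: dominating_set_def I_def)
  qed
  have "\<not> dominating_set F E" if ED: "E \<subset> D" for E
  proof
    assume "dominating_set F E"
    moreover obtain x where "x \<in> D" "x \<notin> E" using ED by blast
    ultimately obtain u where "u \<in> E" "(x, u) \<in> parcs F"
      using D(1) 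
      unfolding dominating_set_def I_def by blast
    then show False using \<open>x \<in> D\<close> ED D(1) by (auto simp: I_def)
  qed
  with dom D(1) show ?thesis by (auto simp: minimal_dominating_set_def I_def)
qed

end

theory Submission
  imports Defs
begin

text \<open>
  When \<open>K\<close> is complete, the vertices \<open>(u, v)\<close> of \<open>G \<circ> K\<close> with a common first coordinate \<open>u\<close> are
  true twins: they are adjacent and have the same closed neighbourhood, namely all pairs whose first
  coordinate lies in the closed neighbourhood of \<open>u\<close> in \<open>G\<close>. So whether a vertex set \<open>S\<close> dominates
  \<open>G \<circ> K\<close> depends only on its projection \<open>fst ` S\<close>
  (\<open>dominating_set_composition_complete_iff\<close>).

  A minimal dominating set therefore cannot contain two vertices of the same fibre, one of them
  being redundant, and the minimal dominating sets of \<open>G \<circ> K\<close> are exactly the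
  sets that project injectively onto a minimal dominating set of \<open>G\<close>
  (\<open>minimal_dominating_set_composition_complete_iff\<close>). Injectivity makes the projection preserve
  cardinality. Conversely, a minimal dominating set \<open>D\<close> of \<open>G\<close> through \<open>x\<close> lifts to
  \<open>D \<times> {y}\<close>, which passes through \<open>(x, y)\<close>. Hence the two minima are taken over the same
  set of cardinalities.
\<close>

lemma complete_parcs_iff:
  assumes "complete_digraph n (with_proj K)"
  shows "(v, v') \<in> parcs K \<longleftrightarrow> v \<in> pverts K \<and> v' \<in> pverts K \<and> v \<noteq> v'"
proof -
  have "parcs K = {(u, v). u \<in> pverts K \<and> v \<in> pverts K \<and> u \<noteq> v}"
    using assms by (simp add: complete_digraph_def arcs_ends_def arc_to_ends_def)
  then show ?thesis by auto
qed

text \<open>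
  The closed neighbourhood of a vertex of \<open>G \<circ> K\<close> is a union of whole fibres, so \<open>S\<close> matters only
  through the fibres that it meets. Passing from \<open>G \<circ> K\<close> to \<open>G\<close> uses that \<open>K\<close> has some
  vertex \<open>y\<close>: a vertex \<open>w\<close> of \<open>G\<close> missed by the projection is dominated because \<open>(w, y)\<close> is.
\<close>

lemma dominating_set_composition_complete_iff:
  assumes K: "simple_graph K" and complete: "complete_digraph n (with_proj K)"
  shows "dominating_set (composition G K) S \<longleftrightarrow>
    S \<subseteq> pverts G \<times> pverts K \<and> dominating_set G (fst ` S)"
proof (cases "S \<subseteq> pverts G \<times> pverts K")
  case S: True
  have arc: "(p, q) \<in> parcs (composition G K) \<longleftrightarrow>
      (fst p, fst q) \<in> parcs G \<or> fst p = fst q \<and> p \<noteq> q"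
    if "p \<in> pverts G \<times> pverts K" "q \<in> pverts G \<times> pverts K" for p q
    using that
    by (auto simp: composition_def complete_parcs_iff[OF complete])
  obtain y where y: "y \<in> pverts K"
    using K by (auto simp: simple_graph_def)
  have "dominating_set (composition G K) S" if dom: "dominating_set G (fst ` S)"
  proof -
    have "\<exists>q\<in>S. (p, q) \<in> parcs (composition G K)"
      if p: "p \<in> pverts G \<times> pverts K" "p \<notin> S" for p
    proof (cases "fst p \<in> fst ` S")
      case True
      \<comment> \<open>The fibre of \<open>p\<close> meets \<open>S\<close>, and by completeness of \<open>K\<close> that fibre is a clique.\<close>
      then obtain q where "q \<in> S" "fst p = fst q" by auto
      then show ?thesis using arc[of p q] p S by blast
    next
      case False
      moreover have "fst p \<in> pverts G" using p by auto
      ultimately obtain q where "q \<in> S" "(fst p, fst q) \<in> parcs G"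
        using dom unfolding dominating_set_def by blast
      then show ?thesis using arc[of p q] p S by blast
    qed
    then show ?thesis using S by (auto simp: dominating_set_def composition_def)
  qed
  moreover have "dominating_set G (fst ` S)" if dom: "dominating_set (composition G K) S"
  proof -
    have "\<exists>u\<in>fst ` S. (w, u) \<in> parcs G" if w: "w \<in> pverts G" "w \<notin> fst ` S" for w
    proof -
      have "(w, y) \<in> pverts G \<times> pverts K" "(w, y) \<notin> S"
        using w y by force+
      then obtain q where q: "q \<in> S" "((w, y), q) \<in> parcs (composition G K)"
        using dom by (fastforce simp: dominating_set_def composition_def)
      then have "(w, fst q) \<in> parcs G \<or> w = fst q"
        using arc[of "(w, y)" q] w y S by auto
      then show ?thesis using q w by blast
    qed
    then show ?thesis using S by (auto simp: dominating_set_def)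
  qed
  ultimately show ?thesis using S by blast
next
  case False
  then show ?thesis by (simp add: dominating_set_def composition_def)
qed

text \<open>
  If two vertices of \<open>S\<close> share a fibre, deleting one leaves the projection, and hence domination,
  unchanged; this forces injectivity. For \<open>S\<close> injective under projection, the subsets of \<open>S\<close>
  correspond to the subsets of \<open>fst ` S\<close>, with domination preserved in both directions, so
  minimality transfers.
\<close>

lemma minimal_dominating_set_composition_complete_iff:
  assumes "simple_graph K" "complete_digraph n (with_proj K)"
  shows "minimal_dominating_set (composition G K) S \<longleftrightarrow>
    S \<subseteq> pverts G \<times> pverts K \<and> inj_on fst S \<and> minimal_dominating_set G (fst ` S)"
    (is "?minH \<longleftrightarrow> ?R")
proof
  note dom_iff = dominating_set_composition_complete_iff[OF assms]
  assume ?minH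
  then have "dominating_set (composition G K) S"
    by (simp add: minimal_dominating_set_def)
  then have S: "S \<subseteq> pverts G \<times> pverts K" "dominating_set G (fst ` S)"
    by (simp_all add: dom_iff)
  have min: "\<not> dominating_set G (fst ` T)" if T: "T \<subset> S" for T
  proof -
    have "\<not> dominating_set (composition G K) T"
      using \<open>?minH\<close> T unfolding minimal_dominating_set_def by blast
    moreover have "T \<subseteq> pverts G \<times> pverts K" using T S(1) by order
    ultimately show ?thesis by (simp add: dom_iff)
  qed
  have "p = q" if pq: "p \<in> S" "q \<in> S" "fst p = fst q" for p q
  proof (rule ccontr)
    assume "p \<noteq> q"
    then have "fst q \<in> fst ` (S - {q})"
      using pq by (intro image_eqI[of _ _ p]) auto
    moreover have "fst ` S = insert (fst q) (fst ` (S - {q}))"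
      using pq(2) by blast
    ultimately have "fst ` (S - {q}) = fst ` S" by (simp add: insert_absorb)
    then show False using min[of "S - {q}"] S(2) pq(2) by auto
  qed
  then have "inj_on fst S" by (rule inj_onI)
  moreover have "\<not> dominating_set G E" if E: "E \<subset> fst ` S" for E
  proof -
    \<comment> \<open>A smaller dominating set of \<open>G\<close> pulls back to a smaller one inside \<open>S\<close>.\<close>
    have "fst ` {p \<in> S. fst p \<in> E} = E" "{p \<in> S. fst p \<in> E} \<subset> S"
      using E by auto
    then show ?thesis using min[of "{p \<in> S. fst p \<in> E}"] by simp
  qed
  ultimately show ?R using S by (auto simp: minimal_dominating_set_def)
next
  note dom_iff = dominating_set_composition_complete_iff[OF assms]
  assume R: ?R
  have "\<not> dominating_set (composition G K) T" if T: "T \<subset> S" for T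
  proof -
    have "fst ` T \<subset> fst ` S"
      using R T by (simp add: image_strict_mono)
    then have "\<not> dominating_set G (fst ` T)"
      using R unfolding minimal_dominating_set_def by blast
    then show ?thesis by (simp add: dom_iff)
  qed
  moreover have "dominating_set (composition G K) S"
    using R by (simp add: minimal_dominating_set_def dom_iff)
  ultimately show ?minH unfolding minimal_dominating_set_def by blast
qed

theorem theorem3p26:
  fixes G :: "'a pair_pre_digraph" and K :: "'b pair_pre_digraph"
    and a :: "nat \<Rightarrow> 'a" and b :: "nat \<Rightarrow> 'b" and m n :: nat
  assumes "simple_graph G" and "bij_betw a {1..m} (pverts G)"
    and "simple_graph K" and "complete_digraph n (with_proj K)"
    and "bij_betw b {1..n} (pverts K)"
  shows "\<forall>i \<in> {1..m}. \<forall>j \<in> {1..n}.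
    domination_degree (composition G K) (a i, b j) = domination_degree G (a i)"
proof (intro ballI)
  fix i j assume "i \<in> {1..m}" "j \<in> {1..n}"
  then have y: "b j \<in> pverts K"
    using assms(5) by (auto dest: bij_betwE)
  note min_iff = minimal_dominating_set_composition_complete_iff[OF assms(3,4)]
  have "{card S | S. minimal_dominating_set (composition G K) S \<and> (a i, b j) \<in> S} =
    {card D | D. minimal_dominating_set G D \<and> a i \<in> D}" (is "?cardsH = ?cardsG")
  proof
    show "?cardsH \<subseteq> ?cardsG"
    proof
      fix k assume "k \<in> ?cardsH"
      then obtain S where S: "k = card S" "inj_on fst S"
          "minimal_dominating_set G (fst ` S)" "(a i, b j) \<in> S"
        by (auto simp: min_iff)
      then have "k = card (fst ` S)" "a i \<in> fst ` S"
        by (auto simp: card_image intro: rev_image_eqI)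
      with S(3) show "k \<in> ?cardsG" by blast
    qed
  next
    show "?cardsG \<subseteq> ?cardsH"
    proof
      fix k assume "k \<in> ?cardsG"
      then obtain D where D: "k = card D" "minimal_dominating_set G D" "a i \<in> D" by blast
      then have "D \<subseteq> pverts G"
        by (simp add: minimal_dominating_set_def dominating_set_def)
      then have "minimal_dominating_set (composition G K) (D \<times> {b j})"
        using D(2) y by (auto simp: min_iff inj_on_def)
      moreover have "k = card (D \<times> {b j})" "(a i, b j) \<in> D \<times> {b j}"
        using D by (simp_all add: card_cartesian_product)
      ultimately show "k \<in> ?cardsH" by blast
    qed
  qed
  then show "domination_degree (composition G K) (a i, b j) = domination_degree G (a i)"
    by (simp add: domination_degree_def)
qed

end
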